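(* Let $\mathrm{Spec}\subseteq\mathcal{E}^\ast$ be any specification and let $\mathit{seqCons}$ denote the formula $\neg D_{\mathrm{Threads}}(\neg\,\mathit{correct})$. Then for every $E\in\mathcal{E}^\infty$, $$(E,\mathrm{len}(E))\models(\mathit{seqCons}\leftrightarrow D_{\mathrm{Threads}}(\mathit{seqCons}))\wedge(\neg\mathit{seqCons}\leftrightarrow D_{\mathrm{Threads}}(\neg\mathit{seqCons})).$$
   Context: Let $\mathrm{Threads}$ be a set, $\mathit{env}\notin\mathrm{Threads}$ an extra element (the environment), and $\mathcal{A}$ a set of actions. The set of events is $\mathcal{E}=(\mathrm{Threads}\uplus\{\mathit{env}\})\times\mathcal{A}$. $\mathcal{E}^\ast$ and $\mathcal{E}^\omega$ are the sets of finite and of infinite sequences over $\mathcal{E}$, and $\mathcal{E}^\infty=\mathcal{E}^\ast\uplus\mathcal{E}^\omega$. $\mathrm{len}(E)\in\mathbb{N}\uplus\{\omega\}$ is the length of $E$ ($\omega$ for infinite sequences). Positions start at $1$; $E\downharpoonright i$ is the prefix of $E$ up to and including position $i$ (all of $E$ if $i\ge\mathrm{len}(E)$, in particular if $i=\omega$). For $t\in\mathrm{Threads}$, $E\downarrow t$ is the sequence obtained from $E$ by erasing all events not of the form $(t,\mathit{act})$ with $\mathit{act}\in\mathcal{A}$. For $(E,i),(E',i')\in\mathcal{E}^\infty\times(\mathbb{N}\uplus\{\omega\})$, $(E,i)\sim_t(E',i')$ iff $(E\downharpoonright i)\downarrow t=(E'\downharpoonright i')\downarrow t$; $\sim_{\mathrm{Threads}}=\bigcap_{t\in\mathrm{Threads}}\sim_t$.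 Satisfaction for $(E,i)\in\mathcal{E}^\infty\times(\mathbb{N}\uplus\{\omega\})$: $(E,i)\models\mathit{correct}$ iff $E\downharpoonright i\in\mathrm{Spec}$; the connectives $\neg,\wedge,\leftrightarrow$ have their usual pointwise meaning; $(E,i)\models D_{\mathrm{Threads}}(\varphi)$ iff $(E',i')\models\varphi$ for all $(E',i')\in\mathcal{E}^\infty\times(\mathbb{N}\uplus\{\omega\})$ with $(E,i)\sim_{\mathrm{Threads}}(E',i')$. *)

theory Defs
  imports "HOL-Library.Stream" "HOL-Library.Extended_Nat"
begin

type_synonym 'e seq = "'e list + 'e stream"

definition seqs :: "'e set \<Rightarrow> 'e seq set" where
  "seqs A = lists A <+> streams A"

fun len :: "'e seq \<Rightarrow> enat" where
  "len (Inl xs) = enat (length xs)"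
| "len (Inr s) = \<infinity>"

text \<open>Positions start at 1, so the prefix up to and including position \<open>n\<close> consists of
  the first \<open>n\<close> elements, and the prefix up to position 0 is empty.\<close>

fun prefix_upto :: "'e seq \<Rightarrow> enat \<Rightarrow> 'e seq" where
  "prefix_upto (Inl xs) (enat n) = Inl (take n xs)"
| "prefix_upto (Inr s) (enat n) = Inl (stake n s)"
| "prefix_upto E \<infinity> = E"

text \<open>The subsequence of the elements satisfying \<open>P\<close>. For an infinite sequence it is infinite
  if \<open>P\<close> holds infinitely often; otherwise it is read off a finite prefix beyond which
  \<open>P\<close> never holds. (The library function \<^const>\<open>sfilter\<close> is meaningful in the former
  case only.)\<close>

fun keep :: "('e \<Rightarrow> bool) \<Rightarrow> 'e seq \<Rightarrow> 'e seq" where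
  "keep P (Inl xs) = Inl (filter P xs)"
| "keep P (Inr s) =
     (if infinite {n. P (s !! n)} then Inr (sfilter P s)
      else Inl (filter P (stake (LEAST n. \<forall>m\<ge>n. \<not> P (s !! m)) s)))"

definition events :: "'p set \<Rightarrow> 'p \<Rightarrow> 'a set \<Rightarrow> ('p \<times> 'a) set" where
  "events Threads env Acts = (Threads \<union> {env}) \<times> Acts"

definition proj :: "'a set \<Rightarrow> 'p \<Rightarrow> ('p \<times> 'a) seq \<Rightarrow> ('p \<times> 'a) seq" where
  "proj Acts t = keep (\<lambda>e. \<exists>act\<in>Acts. e = (t, act))"

type_synonym ('p, 'a) point = "('p \<times> 'a) seq \<times> enat"

definition points :: "'p set \<Rightarrow> 'p \<Rightarrow> 'a set \<Rightarrow> ('p, 'a) point set" where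
  "points Threads env Acts = seqs (events Threads env Acts) \<times> UNIV"

definition indist :: "'a set \<Rightarrow> 'p \<Rightarrow> ('p, 'a) point \<Rightarrow> ('p, 'a) point \<Rightarrow> bool" where
  "indist Acts t = (\<lambda>(E, i) (E', i').
     proj Acts t (prefix_upto E i) = proj Acts t (prefix_upto E' i'))"

definition indist_all :: "'p set \<Rightarrow> 'a set \<Rightarrow> ('p, 'a) point \<Rightarrow> ('p, 'a) point \<Rightarrow> bool" where
  "indist_all Threads Acts p q \<longleftrightarrow> (\<forall>t\<in>Threads. indist Acts t p q)"

text \<open>\<open>DThreads\<close> is distributed knowledge of the group of all threads.\<close>

datatype form =
  Correct
| Neg form
| Conj form form
| Iff form form
| DThreads form

primrec sat :: "'p set \<Rightarrow> 'p \<Rightarrow> 'a set \<Rightarrow> ('p \<times> 'a) list set \<Rightarrow> ('p, 'a) point \<Rightarrow> form \<Rightarrow> bool" where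
  "sat Threads env Acts Spec p Correct \<longleftrightarrow> prefix_upto (fst p) (snd p) \<in> Inl ` Spec"
| "sat Threads env Acts Spec p (Neg \<phi>) \<longleftrightarrow> \<not> sat Threads env Acts Spec p \<phi>"
| "sat Threads env Acts Spec p (Conj \<phi> \<psi>) \<longleftrightarrow>
     sat Threads env Acts Spec p \<phi> \<and> sat Threads env Acts Spec p \<psi>"
| "sat Threads env Acts Spec p (Iff \<phi> \<psi>) \<longleftrightarrow>
     (sat Threads env Acts Spec p \<phi> \<longleftrightarrow> sat Threads env Acts Spec p \<psi>)"
| "sat Threads env Acts Spec p (DThreads \<phi>) \<longleftrightarrow>
     (\<forall>q\<in>points Threads env Acts. indist_all Threads Acts p q \<longrightarrow> sat Threads env Acts Spec q \<phi>)"

definition seqCons :: form where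
  "seqCons = Neg (DThreads (Neg Correct))"

end

(* Indistinguishability by all threads is an equivalence relation, so whether distributed knowledge
   of a formula holds depends only on the class of a point. As seqCons is the negation of
   distributed knowledge, both seqCons and its negation are constant on each class. *)
theory Submission
  imports Defs
begin

lemma indist_all_refl: "indist_all Threads Acts p p"
  by (auto simp: indist_all_def indist_def)

lemma indist_all_sym: "indist_all Threads Acts p q \<Longrightarrow> indist_all Threads Acts q p"
  by (auto simp: indist_all_def indist_def)

lemma indist_all_trans:
  "indist_all Threads Acts p q \<Longrightarrow> indist_all Threads Acts q r \<Longrightarrow> indist_all Threads Acts p r"
  by (auto simp: indist_all_def indist_def)

text \<open>By symmetry and transitivity, \<open>p\<close> and \<open>q\<close> are
  indistinguishable from the same points, so both sides quantify over one set.\<close>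

lemma sat_DThreads_cong:
  assumes "indist_all Threads Acts p q"
  shows "sat Threads env Acts Spec p (DThreads \<phi>) \<longleftrightarrow> sat Threads env Acts Spec q (DThreads \<phi>)"
  using indist_all_trans[OF assms] indist_all_trans[OF indist_all_sym[OF assms]] by auto

lemma sat_seqCons_cong:
  assumes "indist_all Threads Acts p q"
  shows "sat Threads env Acts Spec p seqCons \<longleftrightarrow> sat Threads env Acts Spec q seqCons"
  \<comment> \<open>Only the outer negation is evaluated; \<open>DThreads\<close> stays folded so
    that \<open>sat_DThreads_cong\<close> applies.\<close>
  unfolding seqCons_def sat.simps(2)[of _ _ _ _ _ "DThreads _"]
  using sat_DThreads_cong[OF assms] by blast

text \<open>Constancy of \<open>\<phi>\<close> on the class of \<open>p\<close> gives knowledge from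
  truth. The converse is reflexivity: \<open>p\<close> is itself one of the points quantified
  over.\<close>

lemma sat_iff_DThreads:
  assumes "p \<in> points Threads env Acts"
    and "\<And>q. indist_all Threads Acts p q \<Longrightarrow>
           sat Threads env Acts Spec p \<phi> \<longleftrightarrow> sat Threads env Acts Spec q \<phi>"
  shows "sat Threads env Acts Spec p (Iff \<phi> (DThreads \<phi>))"
  unfolding sat.simps(4,5) using assms indist_all_refl by blast

theorem theorem4:
  fixes Threads :: "'p set" and env :: 'p and Acts :: "'a set"
    and Spec :: "('p \<times> 'a) list set" and E :: "('p \<times> 'a) seq"
  assumes "env \<notin> Threads"
    and "Spec \<subseteq> lists (events Threads env Acts)"
    and "E \<in> seqs (events Threads env Acts)"
  shows "sat Threads env Acts Spec (E, len E)
           (Conj (Iff seqCons (DThreads seqCons))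
                 (Iff (Neg seqCons) (DThreads (Neg seqCons))))"
proof -
  have p: "(E, len E) \<in> points Threads env Acts"
    using assms(3) by (simp add: points_def)
  have "sat Threads env Acts Spec (E, len E) (Iff seqCons (DThreads seqCons))"
    using p sat_seqCons_cong by (rule sat_iff_DThreads)
  moreover have "sat Threads env Acts Spec (E, len E) (Iff (Neg seqCons) (DThreads (Neg seqCons)))"
    \<comment> \<open>Constancy on classes passes from \<open>seqCons\<close> to its
      negation.\<close>
    using p by (rule sat_iff_DThreads) (simp only: sat.simps(2) sat_seqCons_cong)
  ultimately show ?thesis
    by (simp only: sat.simps(3))
qed

end
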